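(* Every real rational knot in $S^3$ has even degree.
   Context: $S^3$ denotes the real quadric $x_1^2+x_2^2+x_3^2+x_4^2=x_0^2$ in $\mathbb{RP}^4$. A real rational curve of degree $d$ in $S^3$ is given by a parametrization $k=[k_0:\dots:k_4]:\mathbb{RP}^1\to S^3\subset\mathbb{RP}^4$ with $k_i$ real homogeneous polynomials of degree $d$ in two variables without common (complex) root; the same polynomials define $\mathbb{C}k:\mathbb{CP}^1\to\mathbb{CP}^4$. It is a real rational knot if $\mathbb{C}k$ is an injective immersion. *)

theory Defs
  imports "HOL-Analysis.Analysis" "HOL-Computational_Algebra.Polynomial"
begin

definition proj_rel :: "'a::field ^ 'n \<Rightarrow> 'a ^ 'n \<Rightarrow> bool" where
  "proj_rel v w \<longleftrightarrow> v \<noteq> 0 \<and> w \<noteq> 0 \<and> (\<exists>c. c \<noteq> 0 \<and> w = c *s v)"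

(* The projective space of lines in 'a ^ 'n; its dimension is CARD('n) - 1. *)
quotient_type (overloaded) ('a, 'n) proj = "'a::field ^ 'n::finite" / partial: proj_rel
proof (rule part_equivpI)
  have "axis undefined 1 \<noteq> (0 :: 'a ^ 'n)" by (simp add: axis_eq_0_iff)
  moreover have "axis undefined 1 = 1 *s (axis undefined 1 :: 'a ^ 'n)" by simp
  ultimately show "\<exists>v :: 'a ^ 'n. proj_rel v v"
    unfolding proj_rel_def by (intro exI[of _ "axis undefined 1"] conjI exI[of _ 1]) auto
next
  show "symp (proj_rel :: 'a ^ 'n \<Rightarrow> _)"
  proof (rule sympI)
    fix v w :: "'a ^ 'n" assume "proj_rel v w"
    then obtain c where "v \<noteq> 0" "w \<noteq> 0" "c \<noteq> 0" "w = c *s v" unfolding proj_rel_def by blast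
    then have "v = inverse c *s w" by (simp add: vector_smult_assoc)
    then show "proj_rel w v"
      unfolding proj_rel_def using \<open>v \<noteq> 0\<close> \<open>w \<noteq> 0\<close> \<open>c \<noteq> 0\<close>
      by (intro conjI exI[of _ "inverse c"]) auto
  qed
next
  show "transp (proj_rel :: 'a ^ 'n \<Rightarrow> _)"
  proof (rule transpI)
    fix u v w :: "'a ^ 'n" assume "proj_rel u v" "proj_rel v w"
    then obtain b c where "u \<noteq> 0" "w \<noteq> 0" "b \<noteq> 0" "c \<noteq> 0" "v = b *s u" "w = c *s v"
      unfolding proj_rel_def by blast
    then show "proj_rel u w"
      unfolding proj_rel_def by (intro conjI exI[of _ "c * b"]) (auto simp: vector_smult_assoc)
  qed
qed

(* abs_proj v is the point with homogeneous coordinates v (meaningful for v \<noteq> 0 only);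
   rep_proj chooses homogeneous coordinates of a point. *)

lemma abs_proj_eq_iff:
  assumes "v \<noteq> 0" "w \<noteq> 0"
  shows "abs_proj v = abs_proj w \<longleftrightarrow> (\<exists>c. c \<noteq> 0 \<and> w = c *s v)"
proof -
  have refl: "proj_rel u u" if "u \<noteq> 0" for u :: "'a ^ 'b"
    unfolding proj_rel_def using that by (intro conjI exI[of _ 1]) auto
  show ?thesis
    using Quotient3_rel[OF Quotient3_proj, of v w] refl[OF assms(1)] refl[OF assms(2)] assms
    by (simp add: proj_rel_def)
qed

lemma rep_proj_nonzero: "rep_proj p \<noteq> 0"
  using Quotient3_rep_reflp[OF Quotient3_proj, of p] by (simp add: proj_rel_def)

lemma abs_rep_proj: "abs_proj (rep_proj p) = p"
  by (rule Quotient3_abs_rep[OF Quotient3_proj])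

lemma rep_abs_proj:
  assumes "v \<noteq> 0"
  obtains c where "c \<noteq> 0" "rep_proj (abs_proj v) = c *s v"
  using abs_proj_eq_iff[OF assms rep_proj_nonzero, of "abs_proj v"] by (auto simp: abs_rep_proj)

(* Sphere in the real projective 4-space, with coordinates indexed 0, ..., 4 in the type 5. *)
definition S3 :: "(real, 5) proj set" where
  "S3 = {abs_proj x | x. x \<noteq> 0 \<and> (x$1)\<^sup>2 + (x$2)\<^sup>2 + (x$3)\<^sup>2 + (x$4)\<^sup>2 = (x$0)\<^sup>2}"

(* A polynomial in two variables is an element of R[X][Y]; coeff (coeff p j) i is the
   coefficient of X^i Y^j. *)
definition homogeneous :: "nat \<Rightarrow> 'a::zero poly poly \<Rightarrow> bool" where
  "homogeneous d p \<longleftrightarrow> (\<forall>i j. coeff (coeff p j) i \<noteq> 0 \<longrightarrow> i + j = d)"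

(* Real polynomials are evaluated both at real and at complex points. *)
definition eval2 :: "real poly poly \<Rightarrow> 'a::real_field ^ 2 \<Rightarrow> 'a" where
  "eval2 p v = poly (poly (map_poly (map_poly of_real) p) [:v$2:]) (v$1)"

definition eval_tuple :: "real poly poly ^ 5 \<Rightarrow> 'a::real_field ^ 2 \<Rightarrow> 'a ^ 5" where
  "eval_tuple k v = (\<chi> i. eval2 (k $ i) v)"

(* At type real this is the parametrization k, at type complex its complexification. *)
definition curve_map :: "real poly poly ^ 5 \<Rightarrow> ('a::real_field, 2) proj \<Rightarrow> ('a, 5) proj" where
  "curve_map k p = abs_proj (eval_tuple k (rep_proj p))"

lemma eval2_altdef:
  fixes v :: "'a::real_field ^ 2"
  shows "eval2 p v = (\<Sum>j\<le>degree (map_poly (map_poly of_real) p :: 'a poly poly).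
     \<Sum>i\<le>degree (map_poly of_real (coeff p j) :: 'a poly).
       of_real (coeff (coeff p j) i) * v$1 ^ i * v$2 ^ j)"
  unfolding eval2_def
  by (simp add: poly_altdef[of "map_poly _ _"] poly_sum poly_power coeff_map_poly sum_distrib_right)

lemma eval2_scale:
  assumes "homogeneous d p"
  shows "eval2 p (c *s v) = c ^ d * eval2 p v"
proof -
  have "of_real (coeff (coeff p j) i) * (c * v$1) ^ i * (c * v$2) ^ j =
        c ^ d * (of_real (coeff (coeff p j) i) * v$1 ^ i * v$2 ^ j)" for i j
  proof (cases "coeff (coeff p j) i = 0")
    case False
    then have "d = i + j" using assms by (auto simp: homogeneous_def)
    then show ?thesis by (simp add: power_mult_distrib power_add mult_ac)
  qed simp
  then show ?thesis
    by (simp only: eval2_altdef sum_distrib_left vector_smult_component)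
qed

(* curve_map does not depend on the homogeneous coordinates chosen by rep_proj. *)
lemma curve_map_abs_proj:
  assumes "\<And>i. homogeneous d (k $ i)" "v \<noteq> 0" "eval_tuple k v \<noteq> 0"
  shows "curve_map k (abs_proj v) = abs_proj (eval_tuple k v)"
proof -
  obtain c where c: "c \<noteq> 0" "rep_proj (abs_proj v) = c *s v"
    using rep_abs_proj[OF assms(2)] .
  have *: "eval_tuple k (c *s v) = c ^ d *s eval_tuple k v"
    by (simp add: eval_tuple_def vec_eq_iff eval2_scale[OF assms(1)])
  have "abs_proj (eval_tuple k v) = abs_proj (c ^ d *s eval_tuple k v)"
    using assms(3) c(1) by (subst abs_proj_eq_iff) auto
  then show ?thesis by (simp add: curve_map_def c(2) *)
qed

definition real_rational_curve :: "nat \<Rightarrow> real poly poly ^ 5 \<Rightarrow> bool" where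
  "real_rational_curve d k \<longleftrightarrow>
     (\<forall>i. homogeneous d (k $ i)) \<and>
     (\<nexists>v :: complex ^ 2. v \<noteq> 0 \<and> (\<forall>i. eval2 (k $ i) v = 0)) \<and>
     range (curve_map k) \<subseteq> S3"

(* The affine chart on the set of points whose j-th coordinate is nonzero; the j-th component
   of the chart is constantly 1, that is, affine space is the hyperplane v $ j = 1. *)
definition chart_domain :: "'n \<Rightarrow> ('a::field, 'n::finite) proj set" where
  "chart_domain j = {p. rep_proj p $ j \<noteq> 0}"

definition chart :: "'n \<Rightarrow> ('a::field, 'n::finite) proj \<Rightarrow> 'a ^ 'n" where
  "chart j p = (\<chi> i. rep_proj p $ i / rep_proj p $ j)"

definition affine_params :: "(complex \<Rightarrow> (complex, 2) proj) set" where
  "affine_params = {\<lambda>z. abs_proj (vector [z, 1]), \<lambda>z. abs_proj (vector [1, z])}"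

(* An immersion of the complex projective line: in affine charts of source and target, the
   differential exists and is injective at every point.  The real differential suffices, as it
   coincides with the complex one for a holomorphic map. *)
definition immersion :: "((complex, 2) proj \<Rightarrow> (complex, 'n::finite) proj) \<Rightarrow> bool" where
  "immersion f \<longleftrightarrow>
     (\<forall>\<phi> \<in> affine_params. \<forall>z j. f (\<phi> z) \<in> chart_domain j \<longrightarrow>
        (\<exists>D. ((\<lambda>w. chart j (f (\<phi> w))) has_derivative D) (at z) \<and> inj D))"

definition real_rational_knot :: "nat \<Rightarrow> real poly poly ^ 5 \<Rightarrow> bool" where
  "real_rational_knot d k \<longleftrightarrow>
     real_rational_curve d k \<and>
     (let Ck = curve_map k :: (complex, 2) proj \<Rightarrow> (complex, 5) proj in inj Ck \<and> immersion Ck)"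

end

(* For odd d the form k_0 satisfies k_0(-v) = -k_0(v), so by the intermediate value theorem on the
   unit circle it has a real zero v. The image of v lies on the quadric
   x_1^2 + ... + x_4^2 = x_0^2, hence all its coordinates vanish; but no point maps to 0. *)
theory Submission
  imports Defs
begin

text \<open>Since \<open>of_real\<close> is injective, \<open>map_poly of_real\<close> preserves
  degrees. The summation bounds thus no longer depend on the field of evaluation, so real and
  complex values can be compared term by term.\<close>

lemma eval2_eq_sum:
  fixes v :: "'a::real_field ^ 2"
  shows "eval2 p v = (\<Sum>j\<le>degree p. \<Sum>i\<le>degree (coeff p j).
    of_real (coeff (coeff p j) i) * v$1 ^ i * v$2 ^ j)"
proof -
  have deg: "degree (map_poly (of_real :: real \<Rightarrow> 'a) q) = degree q" for q
    by (rule degree_map_poly) simp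
  have "degree (map_poly (map_poly (of_real :: real \<Rightarrow> 'a)) p) = degree p"
    by (rule degree_map_poly) (simp add: poly_eq_iff coeff_map_poly)
  then show ?thesis
    by (simp only: eval2_altdef deg)
qed

lemma eval2_of_real:
  fixes v :: "real ^ 2"
  shows "eval2 p (\<chi> i. of_real (v $ i)) = (of_real (eval2 p v) :: 'a::real_field)"
  by (simp add: eval2_eq_sum)

lemma odd_homogeneous_has_real_zero:
  assumes "homogeneous d p" "odd d"
  obtains v :: "real ^ 2" where "v \<noteq> 0" "eval2 p v = 0"
proof -
  define u :: "real \<Rightarrow> real ^ 2" where "u t = vector [cos t, sin t]" for t
  define g where "g t = eval2 p (u t)" for t
  have cont: "continuous_on S g" for S
    unfolding g_def u_def eval2_eq_sum by (simp, intro continuous_intros)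
  have "u pi = (-1) *s u 0"
    by (simp add: u_def vec_eq_iff forall_2)
  then have "g pi = - g 0"
    using assms eval2_scale[OF assms(1), of "-1" "u 0"] by (simp add: g_def)
  \<comment> \<open>The values at 0 and \<open>pi\<close> are opposite, so 0 lies between them; the
    sign of \<open>g 0\<close> decides between the rising and the falling form of the intermediate
    value theorem.\<close>
  then have "\<exists>t. g t = 0"
    using IVT'[of g 0 0 pi] IVT2'[of g pi 0 0] cont by (cases "g 0 \<le> 0") auto
  then obtain t where "g t = 0" ..
  moreover have "u t \<noteq> 0"
    using sin_zero_abs_cos_one[of t] by (auto simp: u_def vec_eq_iff forall_2)
  ultimately show ?thesis
    using that by (simp add: g_def)
qed

lemma forall_5: "(\<forall>i::5. P i) \<longleftrightarrow> P 0 \<and> P 1 \<and> P 2 \<and> P 3 \<and> P 4"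
proof -
  have "i = 0 \<or> i = 1 \<or> i = 2 \<or> i = 3 \<or> i = 4" for i :: 5
  \<comment> \<open>Each element of the type \<open>5\<close> is \<open>of_int z\<close> with 0
    \<le> z < 5.\<close>
  proof (cases i)
    case (of_int z)
    then have "z = 0 \<or> z = 1 \<or> z = 2 \<or> z = 3 \<or> z = 4" by auto
    then show ?thesis using of_int(1) by auto
  qed
  then show ?thesis by metis
qed

text \<open>If the coordinate 0 vanishes, the quadric equation makes a sum of four real squares
  zero, which forces the whole vector to be zero.\<close>

lemma abs_proj_in_S3_coord0_nonzero:
  assumes "abs_proj y \<in> S3" "y \<noteq> 0"
  shows "y $ 0 \<noteq> 0"
proof
  assume "y $ 0 = 0"
  obtain x where x: "x \<noteq> 0" "(x$1)\<^sup>2 + (x$2)\<^sup>2 + (x$3)\<^sup>2 + (x$4)\<^sup>2 = (x$0)\<^sup>2"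
    and "abs_proj y = abs_proj x"
    using assms(1) by (auto simp: S3_def)
  \<comment> \<open>Only the representative \<open>x\<close> is known to satisfy the equation;
    proportionality carries the vanishing of the coordinate 0 from \<open>y\<close> to
    \<open>x\<close>.\<close>
  then obtain c where "x = c *s y"
    using assms(2) by (auto simp: abs_proj_eq_iff)
  with \<open>y $ 0 = 0\<close> have "x $ 0 = 0" by simp
  with x have "x = 0"
    by (simp add: vec_eq_iff forall_5 add_nonneg_eq_0_iff)
  with x show False by simp
qed

lemma real_rational_curve_even_degree:
  assumes "real_rational_curve d k"
  shows "even d"
proof (rule ccontr)
  assume "odd d"
  have hom: "homogeneous d (k $ i)" for i
    using assms by (simp add: real_rational_curve_def)
  obtain v :: "real ^ 2" where v: "v \<noteq> 0" "eval2 (k $ 0) v = 0"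
    using odd_homogeneous_has_real_zero[OF hom \<open>odd d\<close>] .
  \<comment> \<open>The absence of common zeros is stated over the complex numbers, so the real
    point \<open>v\<close> is first viewed as a complex one.\<close>
  have "(\<chi> i. complex_of_real (v $ i)) \<noteq> 0"
    using v(1) by (simp add: vec_eq_iff)
  then have "\<not> (\<forall>i. eval2 (k $ i) (\<chi> i. complex_of_real (v $ i)) = 0)"
    using assms unfolding real_rational_curve_def by blast
  then have nz: "eval_tuple k v \<noteq> 0"
    by (auto simp: eval2_of_real eval_tuple_def vec_eq_iff)
  have "abs_proj (eval_tuple k v) \<in> S3"
    using assms curve_map_abs_proj[OF hom v(1) nz] rangeI[of "curve_map k" "abs_proj v"]
    by (auto simp: real_rational_curve_def)
  then show False
    using abs_proj_in_S3_coord0_nonzero[OF _ nz] v(2) by (simp add: eval_tuple_def)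
qed

theorem mainTheorem3:
  fixes d :: nat and k :: "real poly poly ^ 5"
  assumes "real_rational_knot d k"
  shows "even d"
  using assms real_rational_curve_even_degree unfolding real_rational_knot_def by blast

end
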